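(* Let $l\in\{0,1,2,\dots\}$ and $\hbar\ne0$. Then $\tau_{l+\frac12}(\mathbf t,\hbar)$ is a polynomial in the times, and $$\tau_{l+\frac12}(\mathbf t,\hbar)=C_l\, s_{\lambda(l)}(\tilde{\mathbf t}),\qquad C_l=\frac{(-\hbar)^{\frac{l(l+1)}2}}{2^{l^2}}\prod_{k=1}^l\frac{(2l-2k+1)!}{(l-k)!},$$ where $\lambda(l)=(l,l-1,\dots,1)$ is the staircase partition of $l(l+1)/2$ and $\tilde{\mathbf t}$ is the dilaton-shifted time vector $\tilde t_k=t_k-\frac2\hbar\delta_{k,1}$.
   Context: For $k\ge1$, $j\in\mathbb C$ put $a_k(j)=\prod_{i=1}^k\big(4(j-1)^2-(2i-1)^2\big)$, and for $j\in\mathbb Z$ let $\Phi^{(N)}_j(\lambda)=\lambda^{j-1}\big(1+\sum_{k\ge1}\frac{(-\hbar)^k a_k(j-N)}{16^k k!}\lambda^{-k}\big)$. The generalized BGW tau-function $\tau_N(\mathbf t,\hbar)$ is the formal power series in $\mathbf t=(t_1,t_2,\dots)$ such that for every $M\ge1$, under $t_k=\frac1k\sum_{i=1}^M\lambda_i^{-k}$, $\tau_N=\det_{i,j=1}^M\big(\Phi^{(N)}_j(\lambda_i)\big)/\prod_{i<j}(\lambda_j-\lambda_i)$. Schur functions in times: define $h_k(\mathbf t)$ by $\sum_{k\ge0}h_k(\mathbf t)z^k=\exp\big(\sum_{k\ge1}t_kz^k\big)$ ($h_k=0$ for $k<0$) and, for a partition $\mu=(\mu_1\ge\dots\ge\mu_n)$,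 $s_\mu(\mathbf t)=\det_{i,j=1}^n h_{\mu_i-i+j}(\mathbf t)$. *)

theory Defs
  imports "Jordan_Normal_Form.Determinant" "HOL-Computational_Algebra.Formal_Power_Series"
begin

definition a_coef :: "nat \<Rightarrow> complex \<Rightarrow> complex" where
  "a_coef k j = (\<Prod>i=1..k. 4 * (j - 1)^2 - (2 * of_nat i - 1)^2)"

definition Phi :: "complex \<Rightarrow> complex \<Rightarrow> int \<Rightarrow> complex \<Rightarrow> complex" where
  "Phi N hbar j lam = lam powi (j - 1) *
     (1 + (\<Sum>k. (- hbar) ^ Suc k * a_coef (Suc k) (of_int j - N)
                  / (16 ^ Suc k * fact (Suc k)) * lam powi (- int (Suc k))))"

definition hfun :: "int \<Rightarrow> (nat \<Rightarrow> complex) \<Rightarrow> complex" where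
  "hfun k t = (if k < 0 then 0
     else fps_nth (fps_compose (fps_exp 1) (Abs_fps (\<lambda>n. if n = 0 then 0 else t n))) (nat k))"

definition schur :: "nat list \<Rightarrow> (nat \<Rightarrow> complex) \<Rightarrow> complex" where
  "schur mu t = det (mat (length mu) (length mu)
      (\<lambda>(i, j). hfun (int (mu ! i) - int i + int j) t))"

definition staircase :: "nat \<Rightarrow> nat list" where
  "staircase l = rev [1..<Suc l]"

definition miwa :: "nat \<Rightarrow> (nat \<Rightarrow> complex) \<Rightarrow> nat \<Rightarrow> complex" where
  "miwa M lam k = (\<Sum>i<M. lam i powi (- int k)) / of_nat k"

definition dilaton :: "complex \<Rightarrow> (nat \<Rightarrow> complex) \<Rightarrow> nat \<Rightarrow> complex" where
  "dilaton hbar t k = t k - (if k = 1 then 2 / hbar else 0)"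

definition BGW_det_ratio :: "complex \<Rightarrow> complex \<Rightarrow> nat \<Rightarrow> (nat \<Rightarrow> complex) \<Rightarrow> complex" where
  "BGW_det_ratio N hbar M lam =
     det (mat M M (\<lambda>(i, j). Phi N hbar (int j + 1) (lam i)))
     / (\<Prod>i<M. \<Prod>j\<in>{i<..<M}. (lam j - lam i))"

definition is_BGW_tau :: "complex \<Rightarrow> complex \<Rightarrow> ((nat \<Rightarrow> complex) \<Rightarrow> complex) \<Rightarrow> bool" where
  "is_BGW_tau N hbar T \<longleftrightarrow>
     (\<forall>M\<ge>1. \<forall>lam. inj_on lam {..<M} \<and> (\<forall>i<M. lam i \<noteq> 0) \<longrightarrow>
        T (miwa M lam) = BGW_det_ratio N hbar M lam)"

end

(*
  For N = l + 1/2 every series Phi_j terminates: Phi_j(x) is x^(j-1) times a Bessel polynomial in 1/x.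
  The functions x^l Phi_j are polynomials, one monic of each degree >= l, and they are annihilated by
  the l functionals f |-> [x^(2a+1)] (f(x) exp(2x/hbar)), a < l.  Consider the square matrix whose
  rows are these l functionals and the evaluations at lambda_1, ..., lambda_M, acting on polynomials
  of degree < l + M.  In the basis 1, ..., x^(l-1), x^l Phi_1, ..., x^l Phi_M its determinant is a
  constant times det Phi_j(lambda_i); in the basis 1, ..., x^(M-1), P, x P, ..., x^(l-1) P with
  P = prod (x - lambda_i) it is the Vandermonde determinant times a staircase Jacobi-Trudi determinant
  of the series exp(2z/hbar) prod (1 - z/lambda_i), the inverse of sum h_k(t~) z^k.  Passing from this
  series to its inverse only costs a sign, because a staircase determinant ignores even factors.
*)
theory Submission
  imports Defs "HOL-Computational_Algebra.Polynomial_FPS"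
begin

unbundle fps_syntax
no_notation vec_index (infixl "$" 100)

section \<open>Determinants\<close>

abbreviation detf :: "nat \<Rightarrow> (nat \<Rightarrow> nat \<Rightarrow> 'a :: comm_ring_1) \<Rightarrow> 'a" where
  "detf n f \<equiv> det (mat n n (\<lambda>(i, j). f i j))"

lemma detf_cong:
  assumes "\<And>i j. i < n \<Longrightarrow> j < n \<Longrightarrow> f i j = g i j"
  shows "detf n f = detf n g"
  by (rule arg_cong[of _ _ det], rule eq_matI) (auto simp: assms)

lemma detf_scale:
  "detf n (\<lambda>i j. r i * c j * f i j) = (\<Prod>i<n. r i) * (\<Prod>j<n. c j) * detf n f"
proof -
  have "(\<Prod>i = 0..<n. mat n n (\<lambda>(i, j). r i * c j * f i j) $$ (i, p i))
      = (\<Prod>i<n. r i) * (\<Prod>j<n. c j) * (\<Prod>i = 0..<n. mat n n (\<lambda>(i, j). f i j) $$ (i, p i))"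
    if p: "p permutes {0..<n}" for p
  proof -
    have lt: "p i < n" if "i < n" for i
      using permutes_in_image[OF p, of i] that by simp
    have "(\<Prod>i = 0..<n. mat n n (\<lambda>(i, j). r i * c j * f i j) $$ (i, p i))
        = (\<Prod>i = 0..<n. r i * c (p i) * f i (p i))"
      using lt by (intro prod.cong) auto
    also have "\<dots> = (\<Prod>i = 0..<n. r i) * (\<Prod>i = 0..<n. c (p i)) * (\<Prod>i = 0..<n. f i (p i))"
      by (simp add: prod.distrib)
    also have "(\<Prod>i = 0..<n. c (p i)) = (\<Prod>i = 0..<n. c i)"
      using prod.permute[OF p, of c] by (simp add: o_def)
    also have "(\<Prod>i = 0..<n. f i (p i)) = (\<Prod>i = 0..<n. mat n n (\<lambda>(i, j). f i j) $$ (i, p i))"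
      using lt by (intro prod.cong) auto
    finally show ?thesis by (simp add: atLeast0LessThan)
  qed
  then show ?thesis
    by (simp add: det_def'[of _ n] sum_distrib_left mult_ac)
qed

lemma detf_mult:
  "detf n (\<lambda>i j. \<Sum>k<n. f i k * g k j) = detf n f * detf n g"
proof -
  have "mat n n (\<lambda>(i, j). \<Sum>k<n. f i k * g k j) = mat n n (\<lambda>(i, j). f i j) * mat n n (\<lambda>(i, j). g i j)"
    by (rule eq_matI) (auto simp: scalar_prod_def atLeast0LessThan)
  then show ?thesis
    by (simp add: det_mult[OF mat_carrier mat_carrier])
qed

lemma detf_unitriangular:
  assumes "\<And>i j. i < j \<Longrightarrow> j < n \<Longrightarrow> f i j = 0" "\<And>i. i < n \<Longrightarrow> f i i = 1"
  shows "detf n f = 1"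
proof -
  have "detf n f = prod_list (diag_mat (mat n n (\<lambda>(i, j). f i j)))"
    by (rule det_lower_triangular[of n]) (auto simp: assms)
  also have "diag_mat (mat n n (\<lambda>(i, j). f i j)) = map (\<lambda>_. 1) [0..<n]"
    by (auto simp: diag_mat_def assms)
  also have "prod_list \<dots> = 1"
    by (induction n) auto
  finally show ?thesis .
qed

lemma detf_transpose: "detf n (\<lambda>i j. f j i) = detf n f"
proof -
  have "transpose_mat (mat n n (\<lambda>(i, j). f i j)) = mat n n (\<lambda>(i, j). f j i)"
    by (rule eq_matI) auto
  then show ?thesis
    using det_transpose[of "mat n n (\<lambda>(i, j). f i j)" n] by simp
qed

lemma detf_reverse:
  "detf n (\<lambda>i j. f (n - 1 - i) (n - 1 - j)) = detf n (f :: nat \<Rightarrow> nat \<Rightarrow> 'a :: comm_ring_1)"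
proof -
  \<comment> \<open>The matrix of the reversal. Its determinant is never computed: it enters twice,
    and \<open>R\<close> squared is the identity.\<close>
  define R :: "nat \<Rightarrow> nat \<Rightarrow> 'a" where "R = (\<lambda>i k. if k = n - 1 - i then 1 else 0)"
  have rows: "detf n (\<lambda>i j. g (n - 1 - i) j) = detf n R * detf n g" for g :: "nat \<Rightarrow> nat \<Rightarrow> 'a"
  proof -
    have "(\<Sum>k<n. R i k * g k j) = g (n - 1 - i) j" if "i < n" for i j
      using that by (simp add: R_def if_distrib[of "\<lambda>x. x * _"] sum.delta cong: if_cong)
    then show ?thesis
      unfolding detf_mult[symmetric] by (intro detf_cong) simp
  qed
  have RR: "detf n R * detf n R = 1"
    unfolding rows[symmetric] by (rule detf_unitriangular) (auto simp: R_def)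
  have "detf n (\<lambda>i j. f (n - 1 - i) (n - 1 - j)) = detf n R * detf n (\<lambda>i j. f i (n - 1 - j))"
    by (rule rows[of "\<lambda>i j. f i (n - 1 - j)"])
  also have "detf n (\<lambda>i j. f i (n - 1 - j)) = detf n (\<lambda>i j. f j (n - 1 - i))"
    by (rule detf_transpose[symmetric])
  also have "\<dots> = detf n R * detf n (\<lambda>i j. f j i)"
    by (rule rows[of "\<lambda>i j. f j i"])
  also have "detf n (\<lambda>i j. f j i) = detf n f"
    by (rule detf_transpose)
  finally show ?thesis
    using RR by (simp flip: mult.assoc)
qed

lemma detf_block_upper_right_zero:
  fixes f :: "nat \<Rightarrow> nat \<Rightarrow> 'a :: idom"
  assumes "\<And>i j. i < a \<Longrightarrow> a \<le> j \<Longrightarrow> j < a + b \<Longrightarrow> f i j = 0"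
  shows "detf (a + b) f = detf a f * detf b (\<lambda>i j. f (a + i) (a + j))"
proof -
  have "mat (a + b) (a + b) (\<lambda>(i, j). f i j) =
      four_block_mat (mat a a (\<lambda>(i, j). f i j)) (0\<^sub>m a b)
        (mat b a (\<lambda>(i, j). f (a + i) j)) (mat b b (\<lambda>(i, j). f (a + i) (a + j)))"
    by (rule eq_matI) (auto simp: assms)
  then show ?thesis
    by (simp add: det_four_block_mat_upper_right_zero[of _ a _ b])
qed

text \<open>Moving the last \<open>a\<close> columns to the front costs \<open>a * b\<close>
  transpositions and leaves a block upper triangular matrix.\<close>

lemma detf_block_lower_right_zero:
  fixes f :: "nat \<Rightarrow> nat \<Rightarrow> 'a :: idom"
  assumes "\<And>i j. a \<le> i \<Longrightarrow> i < a + b \<Longrightarrow> b \<le> j \<Longrightarrow> j < a + b \<Longrightarrow> f i j = 0"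
  shows "detf (a + b) f = (- 1) ^ (a * b) * detf a (\<lambda>i j. f i (b + j)) * detf b (\<lambda>i j. f (a + i) j)"
proof -
  have "detf (a + b) f = (- 1) ^ (a * b) * detf (a + b) (\<lambda>i j. f i (if j < a then j + b else j - a))"
    by (subst det_swap_cols[of _ a b], simp, rule arg_cong[of _ _ "\<lambda>x. _ * det x"], rule eq_matI) auto
  also have "mat (a + b) (a + b) (\<lambda>(i, j). f i (if j < a then j + b else j - a)) =
      four_block_mat (mat a a (\<lambda>(i, j). f i (b + j))) (mat a b (\<lambda>(i, j). f i j))
        (0\<^sub>m b a) (mat b b (\<lambda>(i, j). f (a + i) j))"
    by (rule eq_matI) (auto simp: assms add.commute)
  also have "det \<dots> = detf a (\<lambda>i j. f i (b + j)) * detf b (\<lambda>i j. f (a + i) j)"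
    by (subst det_four_block_mat_lower_left_zero[of _ a _ b]) auto
  finally show ?thesis by (simp add: mult_ac)
qed

section \<open>Linear functionals on polynomials, given by their values on the monomials\<close>

definition poly_lin :: "(nat \<Rightarrow> 'a) \<Rightarrow> 'a :: comm_ring_1 poly \<Rightarrow> 'a" where
  "poly_lin w p = (\<Sum>i\<le>degree p. coeff p i * w i)"

lemma poly_lin_lessThan:
  assumes "degree p < n"
  shows "poly_lin w p = (\<Sum>i<n. coeff p i * w i)"
  unfolding poly_lin_def using assms
  by (intro sum.mono_neutral_left) (auto simp: coeff_eq_0)

lemma poly_lin_powers: "poly_lin (\<lambda>i. x ^ i) p = poly p x"
  by (simp add: poly_lin_def poly_altdef)

text \<open>The passage from the monomials to monic polynomials of degrees 0, ..., n - 1 is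
  unitriangular, so a matrix whose rows are functionals has the same determinant in every such
  basis.\<close>

lemma detf_poly_lin_monic:
  fixes p :: "nat \<Rightarrow> 'a :: comm_ring_1 poly"
  assumes "\<And>k. k < n \<Longrightarrow> degree (p k) = k" "\<And>k. k < n \<Longrightarrow> coeff (p k) k = 1"
  shows "detf n (\<lambda>r k. poly_lin (w r) (p k)) = detf n w"
proof -
  have "detf n (\<lambda>r k. poly_lin (w r) (p k)) = detf n (\<lambda>r k. \<Sum>i<n. w r i * coeff (p k) i)"
    by (rule detf_cong) (simp add: poly_lin_lessThan[of _ n] assms mult.commute)
  also have "\<dots> = detf n w * detf n (\<lambda>k i. coeff (p i) k)"
    by (rule detf_mult)
  also have "detf n (\<lambda>k i. coeff (p i) k) = detf n (\<lambda>i k. coeff (p i) k)"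
    by (rule detf_transpose)
  also have "\<dots> = 1"
    by (rule detf_unitriangular) (auto simp: assms coeff_eq_0)
  finally show ?thesis by simp
qed

lemma degree_prod_linear: "degree (\<Prod>i<n. [:- x i, 1:]) = n"
  for x :: "nat \<Rightarrow> 'a :: idom"
  by (induction n) (simp_all add: degree_mult_eq del: mult_pCons_right)

lemma monic_prod_linear: "coeff (\<Prod>i<n. [:- x i, 1:]) n = 1"
  for x :: "nat \<Rightarrow> 'a :: idom"
  using lead_coeff_prod[of "\<lambda>i. [:- x i, 1:]" "{..<n}"] by (simp add: degree_prod_linear)

lemma prod_pairs_Suc:
  fixes g :: "nat \<Rightarrow> nat \<Rightarrow> 'a :: comm_monoid_mult"
  shows "(\<Prod>i<Suc n. \<Prod>j\<in>{i<..<Suc n}. g i j) = (\<Prod>i<n. g i n) * (\<Prod>i<n. \<Prod>j\<in>{i<..<n}. g i j)"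
proof -
  have empty: "{n<..<Suc n} = {}" by auto
  have "(\<Prod>j\<in>{i<..<Suc n}. g i j) = g i n * (\<Prod>j\<in>{i<..<n}. g i j)" if "i < n" for i
  proof -
    have "{i<..<Suc n} = insert n {i<..<n}" using that by auto
    then show ?thesis by simp
  qed
  then show ?thesis
    by (simp add: empty prod.distrib)
qed

lemma detf_vandermonde:
  fixes x :: "nat \<Rightarrow> 'a :: idom"
  shows "detf n (\<lambda>i j. x i ^ j) = (\<Prod>i<n. \<Prod>j\<in>{i<..<n}. (x j - x i))"
proof (induction n)
  case 0
  show ?case by simp
next
  case (Suc n)
  \<comment> \<open>The last monomial gives way to the monic polynomial that vanishes at the first
    \<open>n\<close> points; this clears the last column above its bottom entry.\<close>
  define p where "p k = (if k < n then monom 1 k else \<Prod>i<n. [:- x i, 1:])" for k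
  have "detf (Suc n) (\<lambda>i j. x i ^ j) = detf (Suc n) (\<lambda>i k. poly_lin (\<lambda>j. x i ^ j) (p k))"
    by (rule detf_poly_lin_monic[symmetric])
       (auto simp: p_def degree_monom_eq degree_prod_linear monic_prod_linear less_Suc_eq)
  also have "\<dots> = detf (n + 1) (\<lambda>i k. poly (p k) (x i))"
    by (simp add: poly_lin_powers)
  also have "\<dots> = detf n (\<lambda>i k. poly (p k) (x i)) * detf 1 (\<lambda>i k. poly (p (n + k)) (x (n + i)))"
    by (rule detf_block_upper_right_zero) (auto simp: p_def poly_prod)
  also have "detf n (\<lambda>i k. poly (p k) (x i)) = detf n (\<lambda>i j. x i ^ j)"
    by (rule detf_cong) (simp add: p_def poly_monom)
  also have "detf 1 (\<lambda>i k. poly (p (n + k)) (x (n + i))) = (\<Prod>i<n. x n - x i)"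
    by (subst det_single) (auto simp: p_def poly_prod)
  finally show ?case
    unfolding Suc.IH prod_pairs_Suc by (simp add: mult.commute)
qed

section \<open>Staircase determinants of power series\<close>

text \<open>The staircase Jacobi--Trudi determinant with rows and columns both reversed, so that the
  entries become \<open>F $ (2 * a + 1 - k)\<close> and no longer involve \<open>l\<close>.\<close>

definition staircase_det :: "complex fps \<Rightarrow> nat \<Rightarrow> complex" where
  "staircase_det F l = detf l (\<lambda>a k. if k \<le> 2 * a + 1 then fps_nth F (2 * a + 1 - k) else 0)"

lemma schur_staircase:
  "schur (staircase l) t =
     staircase_det (fps_exp 1 oo Abs_fps (\<lambda>n. if n = 0 then 0 else t n)) l"
proof -
  \<comment> \<open>Row \<open>i = l - 1 - a\<close> has part \<open>l - i\<close>, so with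
    \<open>j = l - 1 - k\<close> the index \<open>(l - i) - i + j\<close> becomes
    \<open>2 * a + 1 - k\<close>. It stays an integer because negative indices must give 0.\<close>
  define f where "f a k = hfun (2 * int a + 1 - int k) t" for a k
  have len: "length (staircase l) = l"
    by (simp add: staircase_def)
  have nth: "staircase l ! i = l - i" if "i < l" for i
    using that by (simp add: staircase_def rev_nth del: upt_Suc)
  have "schur (staircase l) t = detf l (\<lambda>i j. hfun (int (staircase l ! i) - int i + int j) t)"
    by (simp add: schur_def len)
  also have "\<dots> = detf l (\<lambda>i j. f (l - 1 - i) (l - 1 - j))"
  proof (rule detf_cong)
    fix i j assume "i < l" "j < l"
    then have "int (staircase l ! i) - int i + int j = 2 * int (l - 1 - i) + 1 - int (l - 1 - j)"
      by (simp add: nth of_nat_diff)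
    then show "hfun (int (staircase l ! i) - int i + int j) t = f (l - 1 - i) (l - 1 - j)"
      by (simp add: f_def)
  qed
  also have "\<dots> = detf l f"
    by (rule detf_reverse)
  also have "\<dots> = staircase_det (fps_exp 1 oo Abs_fps (\<lambda>n. if n = 0 then 0 else t n)) l"
    unfolding staircase_det_def
  proof (rule detf_cong)
    fix a k :: nat
    have "nat (2 * int a + 1 - int k) = 2 * a + 1 - k" by simp
    then show "f a k = (if k \<le> 2 * a + 1
        then (fps_exp 1 oo Abs_fps (\<lambda>n. if n = 0 then 0 else t n)) $ (2 * a + 1 - k) else 0)"
      unfolding f_def hfun_def by auto
  qed
  finally show ?thesis .
qed

text \<open>Multiplying by an even series only adds multiples of rows to later rows: a staircase Schur
  function does not depend on the even times.\<close>

lemma staircase_det_even_mult: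
  assumes "fps_nth G 0 = 1" "\<And>n. odd n \<Longrightarrow> fps_nth G n = 0"
  shows "staircase_det (G * F) l = staircase_det F l"
proof -
  define e where "e F a k = (if k \<le> 2 * a + 1 then fps_nth F (2 * a + 1 - k) else 0)"
    for F :: "complex fps" and a k
  \<comment> \<open>The unitriangular Toeplitz matrix of the even coefficients of \<open>G\<close>
    carries out the row operations.\<close>
  define L where "L a b = (if b \<le> a then fps_nth G (2 * (a - b)) else 0)" for a b
  have "e (G * F) a k = (\<Sum>b<l. L a b * e F b k)" if "a < l" for a k
  proof -
    \<comment> \<open>The range is widened to an even number of terms, the conditional making the
      added ones zero; it then splits into even-odd pairs, of which only the even half
      survives.\<close>
    have "e (G * F) a k =
        (\<Sum>i\<le>Suc (2 * a). G $ i * (if k + i \<le> 2 * a + 1 then F $ (2 * a + 1 - k - i) else 0))"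
    proof (cases "k \<le> 2 * a + 1")
      case True
      have "e (G * F) a k = (\<Sum>i=0..2 * a + 1 - k. G $ i * F $ (2 * a + 1 - k - i))"
        using True by (simp add: e_def fps_mult_nth)
      also have "\<dots> = (\<Sum>i=0..2 * a + 1 - k. G $ i * (if k + i \<le> 2 * a + 1 then F $ (2 * a + 1 - k - i) else 0))"
        using True by (intro sum.cong) auto
      also have "\<dots> = (\<Sum>i\<le>Suc (2 * a). G $ i * (if k + i \<le> 2 * a + 1 then F $ (2 * a + 1 - k - i) else 0))"
        by (rule sum.mono_neutral_left) auto
      finally show ?thesis .
    next
      case False
      then show ?thesis by (auto simp: e_def intro!: sum.neutral)
    qed
    also have "\<dots> = (\<Sum>s\<le>a. G $ (2 * s) * (if k + 2 * s \<le> 2 * a + 1 then F $ (2 * a + 1 - k - 2 * s) else 0))"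
      unfolding sum.in_pairs_0 by (intro sum.cong) (auto simp: assms)
    also have "\<dots> = (\<Sum>s\<le>a. G $ (2 * s) * e F (a - s) k)"
    proof (rule sum.cong)
      fix s assume "s \<in> {..a}"
      then have "s \<le> a" by simp
      then have "2 * (a - s) + 1 - k = 2 * a + 1 - k - 2 * s" "k \<le> 2 * (a - s) + 1 \<longleftrightarrow> k + 2 * s \<le> 2 * a + 1"
        by auto
      then show "G $ (2 * s) * (if k + 2 * s \<le> 2 * a + 1 then F $ (2 * a + 1 - k - 2 * s) else 0) =
          G $ (2 * s) * e F (a - s) k"
        unfolding e_def by presburger
    qed simp
    also have "\<dots> = (\<Sum>b\<le>a. G $ (2 * (a - b)) * e F b k)"
      by (rule sum.reindex_bij_witness[of _ "\<lambda>b. a - b" "\<lambda>s. a - s"]) auto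
    also have "\<dots> = (\<Sum>b\<le>a. L a b * e F b k)"
      by (intro sum.cong) (auto simp: L_def)
    also have "\<dots> = (\<Sum>b<l. L a b * e F b k)"
      using that by (intro sum.mono_neutral_left) (auto simp: L_def)
    finally show ?thesis .
  qed
  then have "detf l (e (G * F)) = detf l (\<lambda>a k. \<Sum>b<l. L a b * e F b k)"
    by (intro detf_cong) auto
  also have "\<dots> = detf l L * detf l (e F)"
    by (rule detf_mult)
  also have "detf l L = 1"
    by (rule detf_unitriangular) (auto simp: L_def assms)
  finally show ?thesis
    unfolding staircase_det_def e_def by simp
qed

text \<open>The index \<open>2 * a + 1 - k\<close> has the parity of \<open>k + 1\<close>, whatever
  \<open>a\<close> is, so a reflection of the variable only changes signs of whole columns.\<close>

lemma staircase_det_reflect: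
  "staircase_det (F oo - fps_X) l = (\<Prod>k<l. (- 1) ^ (k + 1)) * staircase_det F l"
proof -
  have "staircase_det (F oo - fps_X) l =
      detf l (\<lambda>a k. 1 * (- 1) ^ (k + 1) * (if k \<le> 2 * a + 1 then fps_nth F (2 * a + 1 - k) else 0))"
    unfolding staircase_det_def
  proof (rule detf_cong)
    fix a k :: nat
    have "(- 1) ^ (2 * a + 1 - k) = (- 1 :: complex) ^ (k + 1)" if "k \<le> 2 * a + 1"
    proof -
      have "even (2 * a + 1 - k) \<longleftrightarrow> even (k + 1)"
        using that by presburger
      then show ?thesis by (simp add: minus_one_power_iff)
    qed
    then show "(if k \<le> 2 * a + 1 then (F oo - fps_X) $ (2 * a + 1 - k) else 0) =
        1 * (- 1) ^ (k + 1) * (if k \<le> 2 * a + 1 then F $ (2 * a + 1 - k) else 0)"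
      by (simp add: fps_compose_uminus')
  qed
  then show ?thesis
    unfolding detf_scale by (simp add: staircase_det_def)
qed

lemma staircase_det_inverse:
  assumes "H * Q = 1" "fps_nth Q 0 = 1"
  shows "staircase_det Q l = (\<Prod>k<l. (- 1) ^ (k + 1)) * staircase_det H l"
proof -
  \<comment> \<open>\<open>1 / H(z)\<close> is \<open>H(-z)\<close> times the even series \<open>1 / (H(z) H(-z))\<close>.\<close>
  define G where "G = Q * (Q oo - fps_X)"
  have refl2: "(F oo - fps_X) oo - fps_X = F" for F :: "complex fps"
    by (rule fps_ext) (simp add: fps_compose_uminus' flip: mult.assoc power_mult_distrib)
  have "G oo - fps_X = G"
    by (simp add: G_def fps_compose_mult_distrib refl2 mult.commute)
  then have sym: "(- 1) ^ n * G $ n = G $ n" for n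
    by (metis fps_compose_uminus' fps_nth_Abs_fps)
  have "G $ n = 0" if "odd n" for n
    using sym[of n] that by simp
  moreover have "G $ 0 = 1"
    by (simp add: G_def assms)
  moreover have "Q = G * (H oo - fps_X)"
  proof -
    have "(Q oo - fps_X) * (H oo - fps_X) = 1"
      using assms(1) by (simp add: mult.commute flip: fps_compose_mult_distrib)
    then show ?thesis by (simp add: G_def mult.assoc)
  qed
  ultimately have "staircase_det Q l = staircase_det (H oo - fps_X) l"
    using staircase_det_even_mult by metis
  then show ?thesis by (simp add: staircase_det_reflect)
qed

section \<open>The staircase determinant of the exponential series\<close>

lemma poly_falling_factorial:
  "poly (\<Prod>i<k. [:- of_nat i, 1:]) (of_nat n) =
     (if k \<le> n then fact n / fact (n - k) else 0 :: 'a :: field_char_0)"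
proof (cases "k \<le> n")
  case True
  then have "poly (\<Prod>i<k. [:- of_nat i, 1:]) (of_nat n) = (fact n / fact (n - k) :: 'a)"
  proof (induction k)
    case (Suc k)
    then have "n - k = Suc (n - Suc k)" by simp
    then have "fact (n - k) = (of_nat (n - k) * fact (n - Suc k) :: 'a)"
      by (metis fact_Suc)
    moreover have "of_nat (n - k) \<noteq> (0 :: 'a)"
      using Suc.prems by simp
    moreover have "poly (\<Prod>i<Suc k. [:- of_nat i, 1:]) (of_nat n) = (fact n / fact (n - k) * of_nat (n - k) :: 'a)"
      using Suc by (simp add: of_nat_diff del: mult_pCons_right)
    ultimately show ?case by (simp del: mult_pCons_right)
  qed simp
  then show ?thesis using True by simp
next
  case False
  then show ?thesis by (auto simp: poly_prod intro!: prod_zero bexI[of _ n])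
qed

text \<open>Up to row factors \<open>c ^ (2 * a + 1) / fact (2 * a + 1)\<close> and column factors
  \<open>1 / c ^ k\<close>, the entry is the \<open>k\<close>-th falling factorial of
  \<open>2 * a + 1\<close>, which also vanishes for \<open>k > 2 * a + 1\<close>. Falling factorials
  are monic, so powers may replace them; what remains is the Vandermonde determinant of the nodes 1,
  3, 5, ....\<close>

lemma staircase_det_exp:
  assumes "c \<noteq> 0"
  shows "staircase_det (fps_exp c) l = (\<Prod>m<l. c ^ (m + 1) * 2 ^ m * fact m / fact (2 * m + 1))"
proof -
  define x :: "nat \<Rightarrow> complex" where "x a = of_nat (2 * a + 1)" for a
  define p :: "nat \<Rightarrow> complex poly" where "p k = (\<Prod>i<k. [:- of_nat i, 1:])" for k
  have "staircase_det (fps_exp c) l =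
      detf l (\<lambda>a k. (c ^ (2 * a + 1) / fact (2 * a + 1)) * (1 / c ^ k) * poly (p k) (x a))"
    unfolding staircase_det_def x_def p_def poly_falling_factorial
    using assms by (intro detf_cong) (auto simp: power_diff simp del: fact_Suc)
  also have "\<dots> = (\<Prod>a<l. c ^ (2 * a + 1) / fact (2 * a + 1)) * (\<Prod>k<l. 1 / c ^ k) *
      detf l (\<lambda>a k. poly (p k) (x a))"
    by (rule detf_scale)
  also have "detf l (\<lambda>a k. poly (p k) (x a)) = detf l (\<lambda>a k. x a ^ k)"
    unfolding poly_lin_powers[symmetric]
    by (rule detf_poly_lin_monic) (simp_all add: p_def degree_prod_linear monic_prod_linear)
  also have "\<dots> = (\<Prod>m<l. 2 ^ m * fact m)"
    unfolding detf_vandermonde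
  proof (induction l)
    case (Suc l)
    \<comment> \<open>The new node lies at distances 2, 4, ..., 2 l from the earlier ones.\<close>
    have "(\<Prod>i<l. x l - x i) = (\<Prod>i<l. 2 * of_nat (l - i))"
      by (intro prod.cong) (auto simp: x_def of_nat_diff)
    also have "\<dots> = 2 ^ l * (\<Prod>i<l. of_nat (l - i))"
      by (simp only: prod.distrib prod_constant card_lessThan)
    also have "(\<Prod>i<l. of_nat (l - i)) = (\<Prod>i\<in>{1..l}. of_nat i :: complex)"
      by (rule prod.reindex_bij_witness[of _ "\<lambda>i. l - i" "\<lambda>i. l - i"]) auto
    also have "\<dots> = fact l"
      by (simp add: fact_prod)
    finally show ?case
      unfolding prod_pairs_Suc Suc.IH by (simp add: mult_ac)
  qed simp
  also have "(\<Prod>a<l. c ^ (2 * a + 1) / fact (2 * a + 1)) * (\<Prod>k<l. 1 / c ^ k) * (\<Prod>m<l. 2 ^ m * fact m) =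
      (\<Prod>m<l. c ^ (m + 1) * 2 ^ m * fact m / fact (2 * m + 1))"
    unfolding prod.distrib[symmetric]
  proof (rule prod.cong)
    fix m
    have "c ^ (2 * m + 1) = c ^ (m + 1) * c ^ m"
      by (simp add: mult_2 flip: power_add)
    then show "c ^ (2 * m + 1) / fact (2 * m + 1) * (1 / c ^ m) * (2 ^ m * fact m) =
        c ^ (m + 1) * 2 ^ m * fact m / fact (2 * m + 1)"
      using assms by (simp del: power_Suc)
  qed simp
  finally show ?thesis .
qed

section \<open>The generating series of the complete symmetric functions at Miwa times\<close>

lemma fps_exp_compose_mult_eq_1:
  fixes T Q :: "'a :: field_char_0 fps"
  assumes "T $ 0 = 0" "Q $ 0 = 1" "fps_deriv Q = - fps_deriv T * Q"
  shows "(fps_exp 1 oo T) * Q = 1"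
proof -
  \<comment> \<open>The logarithmic derivatives of the two factors cancel, so the product equals its
    constant term.\<close>
  have "fps_deriv ((fps_exp 1 oo T) * Q) = 0"
    by (simp add: fps_compose_deriv assms algebra_simps)
  then have "(fps_exp 1 oo T) * Q = fps_const (((fps_exp 1 oo T) * Q) $ 0)"
    by (simp only: fps_deriv_eq_0_iff)
  also have "((fps_exp 1 oo T) * Q) $ 0 = 1"
    by (simp add: assms)
  finally show ?thesis by simp
qed

text \<open>Newton's identities in generating function form: the logarithmic derivative of the
  product is minus the series of power sums, here multiplied out.\<close>

lemma fps_deriv_prod_linear:
  fixes x :: "nat \<Rightarrow> 'a :: field"
  shows "fps_deriv (\<Prod>i<M. 1 - fps_const (x i) * fps_X) =
    - Abs_fps (\<lambda>n. \<Sum>i<M. x i ^ Suc n) * (\<Prod>i<M. 1 - fps_const (x i) * fps_X)"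
proof (induction M)
  case 0
  have "Abs_fps (\<lambda>n. 0) = (0 :: 'a fps)" by (rule fps_ext) simp
  then show ?case by simp
next
  case (Suc M)
  have split: "Abs_fps (\<lambda>n. \<Sum>i<Suc M. x i ^ Suc n) =
      Abs_fps (\<lambda>n. \<Sum>i<M. x i ^ Suc n) + Abs_fps (\<lambda>n. x M ^ Suc n)"
    by (rule fps_ext) simp
  \<comment> \<open>The geometric series is what the new factor adds to the logarithmic derivative,
    up to sign.\<close>
  have geom: "Abs_fps (\<lambda>n. x M ^ Suc n) * (1 - fps_const (x M) * fps_X) = fps_const (x M)"
  proof (rule fps_ext)
    fix n
    show "(Abs_fps (\<lambda>n. x M ^ Suc n) * (1 - fps_const (x M) * fps_X)) $ n = fps_const (x M) $ n"
      by (cases n) (simp_all add: right_diff_distrib mult.left_commute[of _ "fps_const _"] flip: mult.assoc)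
  qed
  define A where "A = (\<Prod>i<M. 1 - fps_const (x i) * fps_X)"
  define B where "B = 1 - fps_const (x M) * fps_X"
  define S where "S = Abs_fps (\<lambda>n. \<Sum>i<M. x i ^ Suc n)"
  define R where "R = Abs_fps (\<lambda>n. x M ^ Suc n)"
  have "fps_deriv (A * B) = fps_deriv A * B + A * - fps_const (x M)"
    by (simp add: B_def)
  also have "\<dots> = - (S + R) * (A * B)"
    using Suc.IH geom[symmetric] unfolding A_def[symmetric] B_def[symmetric] S_def[symmetric] R_def[symmetric]
    by (simp add: algebra_simps)
  finally show ?case
    unfolding split prod.lessThan_Suc A_def B_def S_def R_def .
qed

text \<open>At Miwa times, \<open>k\<close> times the \<open>k\<close>-th time is the
  \<open>k\<close>-th power sum of the \<open>1 / lam i\<close>, so exponentiating the times inverts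
  the product; the dilaton shift inverts the factor \<open>fps_exp (2 / hbar)\<close>.\<close>

lemma exp_miwa_times:
  assumes "hbar \<noteq> 0" "\<And>i. i < M \<Longrightarrow> lam i \<noteq> 0"
  shows "(fps_exp 1 oo Abs_fps (\<lambda>n. if n = 0 then 0 else dilaton hbar (miwa M lam) n)) *
    (fps_exp (2 / hbar) * (\<Prod>i<M. 1 - fps_const (1 / lam i) * fps_X)) = 1"
proof (rule fps_exp_compose_mult_eq_1)
  let ?P = "\<Prod>i<M. 1 - fps_const (1 / lam i) * fps_X"
  let ?T = "Abs_fps (\<lambda>n. if n = 0 then 0 else dilaton hbar (miwa M lam) n)"
  let ?S = "Abs_fps (\<lambda>n. \<Sum>i<M. (1 / lam i) ^ Suc n)"
  show "?T $ 0 = 0" by simp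
  show "(fps_exp (2 / hbar) * ?P) $ 0 = 1"
    by (induction M) simp_all
  have "fps_deriv ?T = ?S - fps_const (2 / hbar)"
  proof (rule fps_ext)
    fix n
    have "(\<Sum>i<M. lam i powi - int (Suc n)) = (\<Sum>i<M. (1 / lam i) ^ Suc n)"
      by (intro sum.cong) (simp_all add: power_int_minus power_one_over inverse_eq_divide del: of_nat_Suc power_Suc)
    moreover have "of_nat (Suc n) \<noteq> (0 :: complex)" by (simp del: of_nat_Suc)
    \<comment> \<open>Differentiation moves the shift of the first time to the constant term, hence
      the separate case \<open>n = 0\<close>.\<close>
    ultimately show "fps_deriv ?T $ n = (?S - fps_const (2 / hbar)) $ n"
      by (cases "n = 0") (simp_all add: dilaton_def miwa_def of_nat_1[unfolded One_nat_def] del: of_nat_Suc power_Suc)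
  qed
  then show "fps_deriv (fps_exp (2 / hbar) * ?P) = - fps_deriv ?T * (fps_exp (2 / hbar) * ?P)"
    by (simp only: fps_deriv_mult fps_exp_deriv fps_deriv_prod_linear) (simp add: algebra_simps)
qed

section \<open>Bessel polynomials\<close>

lemma coeff_even_power_odd:
  assumes "odd s"
  shows "coeff ([:a, 0, b:] ^ n) s = (0 :: 'a :: comm_ring_1)"
  using assms
proof (induction n arbitrary: s)
  case 0
  then show ?case by (cases s) auto
next
  case (Suc n)
  have "coeff ([:a, 0, b:] ^ n) s = 0"
    using Suc by simp
  moreover have "coeff (pCons 0 (pCons 0 (smult b ([:a, 0, b:] ^ n)))) s = 0"
  proof (cases s)
    case (Suc s')
    note s' = this
    show ?thesis
    proof (cases s')
      case 0
      then show ?thesis using s' by simp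
    next
      case (Suc s'')
      then show ?thesis using s' Suc.prems Suc.IH[of s''] by simp
    qed
  qed simp
  ultimately show ?case by simp
qed

lemma coeff_one_plus_X_power: "coeff ([:1, 1:] ^ n) s = (of_nat (n choose s) :: 'a :: idom)"
proof (cases "s \<le> n")
  case True
  then show ?thesis by (simp add: coeff_linear_poly_power)
next
  case False
  then show ?thesis by (simp add: coeff_eq_0 degree_power_eq binomial_eq_0)
qed

lemma sum_binomial_odd_eq_0:
  assumes "odd s"
  shows "(\<Sum>m\<le>n. of_nat (n choose m) * (- 1 / 2) ^ m * of_nat ((n + m) choose s)) = (0 :: 'a :: field_char_0)"
proof -
  \<comment> \<open>The sum is the coefficient of \<open>X ^ s\<close> in \<open>(1 + X) ^ n (1 - (1 + X) / 2) ^ n = ((1 - X\<^sup>2) / 2) ^ n\<close>.\<close>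
  define a :: 'a where "a = - 1 / 2"
  define y where "y = ([:1, 1:] :: 'a poly)"
  have "[:1 / 2, 0, - 1 / 2:] ^ n = (y * (smult a y + 1)) ^ n"
    by (simp add: y_def a_def one_pCons)
  also have "\<dots> = y ^ n * (\<Sum>m\<le>n. of_nat (n choose m) * (smult a y) ^ m * 1 ^ (n - m))"
    by (simp only: power_mult_distrib binomial_ring)
  also have "\<dots> = (\<Sum>m\<le>n. smult (of_nat (n choose m) * a ^ m) (y ^ (n + m)))"
    unfolding sum_distrib_left
    by (intro sum.cong) (simp_all add: smult_power power_add of_nat_poly mult_ac)
  finally have "(\<Sum>m\<le>n. of_nat (n choose m) * a ^ m * of_nat ((n + m) choose s)) =
      coeff ([:1 / 2, 0, - 1 / 2 :: 'a:] ^ n) s"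
    by (simp add: y_def coeff_sum coeff_one_plus_X_power)
  then show ?thesis
    using assms by (simp add: a_def coeff_even_power_odd)
qed

text \<open>The coefficients, by powers of \<open>1 / x\<close>, of the Bessel polynomial
  \<open>y_n\<close> at \<open>- hbar / (2 * x)\<close>. Because \<open>n - m\<close> truncates,
  they are meant for \<open>m \<le> n\<close>.\<close>

definition bessel_coef :: "complex \<Rightarrow> nat \<Rightarrow> nat \<Rightarrow> complex" where
  "bessel_coef hbar n m = (- hbar / 4) ^ m * fact (n + m) / (fact (n - m) * fact m)"

lemma bessel_coef_0: "bessel_coef hbar n 0 = 1"
  by (simp add: bessel_coef_def)

text \<open>The Bessel polynomial in \<open>1 / x\<close> multiplied by \<open>x ^ k\<close>; for
  \<open>n \<le> k\<close> no exponent is truncated.\<close>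

definition bessel_monic :: "complex \<Rightarrow> nat \<Rightarrow> nat \<Rightarrow> complex poly" where
  "bessel_monic hbar n k = (\<Sum>m\<le>n. monom (bessel_coef hbar n m) (k - m))"

lemma bessel_monic_split:
  assumes "n \<le> k"
  obtains q where "bessel_monic hbar n k = monom 1 k + q" "\<And>i. i \<ge> k \<Longrightarrow> coeff q i = 0"
proof
  let ?q = "\<Sum>m<n. monom (bessel_coef hbar n (Suc m)) (k - Suc m)"
  show "bessel_monic hbar n k = monom 1 k + ?q"
    by (simp add: bessel_monic_def sum.atMost_shift bessel_coef_0)
  show "coeff ?q i = 0" if "i \<ge> k" for i
    using that assms by (auto simp: coeff_sum intro!: sum.neutral)
qed

lemma coeff_bessel_monic: "n \<le> k \<Longrightarrow> coeff (bessel_monic hbar n k) k = 1"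
  by (metis add.right_neutral bessel_monic_split coeff_add coeff_monom order_refl)

lemma degree_bessel_monic:
  assumes "n \<le> k"
  shows "degree (bessel_monic hbar n k) = k"
proof (rule antisym)
  show "k \<le> degree (bessel_monic hbar n k)"
    using coeff_bessel_monic[OF assms, of hbar] by (intro le_degree) simp
  show "degree (bessel_monic hbar n k) \<le> k"
    by (rule bessel_monic_split[OF assms, of hbar]) (auto intro!: degree_le)
qed

text \<open>For \<open>k = l + j\<close> with \<open>j\<close> counted from zero, \<open>bessel_index l k\<close> is the number \<open>n\<close> with
  \<open>2 n + 1 = \<bar>2 j - 2 l - 1\<bar>\<close>, the degree of the Bessel polynomial into which the series for
  \<open>\<Phi>\<^sub>j\<^sub>+\<^sub>1\<close> terminates.\<close>

definition bessel_index :: "nat \<Rightarrow> nat \<Rightarrow> nat" where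
  "bessel_index l k = (if k \<le> 2 * l then 2 * l - k else k - 2 * l - 1)"

text \<open>The \<open>i\<close>-th factor is
  \<open>(2 * n + 1)^2 - (2 * i - 1)^2 = 4 * (n + 1 - i) * (n + i)\<close>: the factors collect into
  factorials, and the one at \<open>i = n + 1\<close> is zero. The squared hypothesis admits both
  signs of \<open>z - 1\<close>.\<close>

lemma a_coef_half_integer:
  assumes "4 * (z - 1)\<^sup>2 = (2 * of_nat n + 1)\<^sup>2"
  shows "a_coef k z = (if k \<le> n then 4 ^ k * fact (n + k) / fact (n - k) else 0)"
proof (cases "k \<le> n")
  case True
  then have "a_coef k z = 4 ^ k * fact (n + k) / fact (n - k)"
  proof (induction k)
    case (Suc k)
    then have "n - k = Suc (n - Suc k)" by simp
    define d :: complex where "d = of_nat (n - k)"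
    have "fact (n - k) = d * fact (n - Suc k)"
      unfolding d_def by (metis \<open>n - k = Suc (n - Suc k)\<close> fact_Suc)
    moreover have "d \<noteq> 0"
      using Suc.prems by (simp add: d_def)
    moreover have "4 * (z - 1)\<^sup>2 - (2 * of_nat (Suc k) - 1)\<^sup>2 = 4 * d * of_nat (Suc (n + k))"
      unfolding assms d_def using Suc.prems by (simp add: of_nat_diff algebra_simps power2_eq_square)
    moreover have "a_coef (Suc k) z = a_coef k z * (4 * (z - 1)\<^sup>2 - (2 * of_nat (Suc k) - 1)\<^sup>2)"
      by (simp add: a_coef_def)
    moreover have "a_coef k z = 4 ^ k * fact (n + k) / fact (n - k)"
      using Suc by simp
    ultimately show ?case
      by (simp add: mult_ac del: of_nat_Suc)
  qed (simp add: a_coef_def)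
  then show ?thesis using True by simp
next
  case False
  have "4 * (z - 1)\<^sup>2 - (2 * of_nat (Suc n) - 1)\<^sup>2 = 0"
    unfolding assms by (simp add: add.commute)
  then have "a_coef k z = 0"
    unfolding a_coef_def using False by (intro prod_zero bexI[of _ "Suc n"]) auto
  then show ?thesis using False by simp
qed

lemma Phi_half_integer:
  assumes "lam \<noteq> 0"
  shows "Phi (of_nat l + 1/2) hbar (int j + 1) lam =
    poly (bessel_monic hbar (bessel_index l (l + j)) (l + j)) lam / lam ^ l"
proof -
  define n where "n = bessel_index l (l + j)"
  have "n \<le> l + j"
    by (auto simp: n_def bessel_index_def)
  define z where "z = of_int (int j + 1) - (of_nat l + 1/2 :: complex)"
  \<comment> \<open>Here \<open>z - 1 = j - l - 1/2\<close>; the two branches of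
    \<open>bessel_index\<close> correspond to its two signs.\<close>
  have z: "4 * (z - 1)\<^sup>2 = (2 * of_nat n + 1)\<^sup>2"
    by (auto simp: z_def n_def bessel_index_def of_nat_diff power2_eq_square algebra_simps)
  define f where "f k = (- hbar) ^ Suc k * a_coef (Suc k) z / (16 ^ Suc k * fact (Suc k)) * lam powi (- int (Suc k))" for k
  have f: "f k = (if Suc k \<le> n then bessel_coef hbar n (Suc k) / lam ^ Suc k else 0)" for k
  proof -
    \<comment> \<open>The powers of 4 come from \<open>a_coef\<close>, those of 16 from
      \<open>Phi\<close>.\<close>
    have "(- hbar) ^ Suc k * 4 ^ Suc k / 16 ^ Suc k = (- hbar * 4 / 16) ^ Suc k"
      by (simp only: power_mult_distrib power_divide)
    also have "\<dots> = (- hbar / 4) ^ Suc k"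
      by simp
    finally have pow: "(- hbar) ^ Suc k * 4 ^ Suc k / 16 ^ Suc k = (- hbar / 4) ^ Suc k" .
    have alg: "x * (y * F / G) / (z * K) * (1 / L) = b * F / (G * K) / L" if "x * y / z = b"
      for x y z b F G K L :: complex
      unfolding that[symmetric] by (simp add: mult_ac)
    have lam: "lam powi (- int (Suc k)) = 1 / lam ^ Suc k"
      by (simp only: power_int_minus power_int_of_nat inverse_eq_divide)
    show ?thesis
    proof (cases "Suc k \<le> n")
      case True
      then show ?thesis
        unfolding f_def a_coef_half_integer[OF z] bessel_coef_def
        by (simp only: if_True lam alg[OF pow])
    next
      case False
      then show ?thesis
        by (simp add: f_def a_coef_half_integer[OF z])
    qed
  qed
  have "(\<Sum>k. f k) = (\<Sum>k<n. f k)"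
    by (rule suminf_finite) (auto simp: f)
  also have "\<dots> = (\<Sum>k<n. bessel_coef hbar n (Suc k) / lam ^ Suc k)"
    by (intro sum.cong) (auto simp: f)
  finally have "1 + (\<Sum>k. f k) = (\<Sum>m\<le>n. bessel_coef hbar n m / lam ^ m)"
    by (simp add: sum.atMost_shift bessel_coef_0 del: power_Suc)
  then have "Phi (of_nat l + 1/2) hbar (int j + 1) lam = lam ^ j * (\<Sum>m\<le>n. bessel_coef hbar n m / lam ^ m)"
    unfolding Phi_def f_def z_def by simp
  also have "\<dots> = (\<Sum>m\<le>n. bessel_coef hbar n m * lam ^ (l + j - m)) / lam ^ l"
    unfolding sum_distrib_left sum_divide_distrib
    using \<open>n \<le> l + j\<close> assms
    by (intro sum.cong) (simp_all add: power_diff power_add)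
  finally show ?thesis
    by (simp add: bessel_monic_def poly_sum poly_monom n_def)
qed

section \<open>Coefficient functionals that annihilate the Bessel polynomials\<close>

lemma poly_lin_fps_nth:
  "poly_lin (\<lambda>i. if i \<le> n then F $ (n - i) else 0) p = (fps_of_poly p * F) $ n"
proof -
  have "(fps_of_poly p * F) $ n = (\<Sum>i=0..n. coeff p i * (if i \<le> n then F $ (n - i) else 0))"
    by (simp add: fps_mult_nth)
  also have "\<dots> = (\<Sum>i<Suc (n + degree p). coeff p i * (if i \<le> n then F $ (n - i) else 0))"
    by (rule sum.mono_neutral_left) auto
  also have "\<dots> = poly_lin (\<lambda>i. if i \<le> n then F $ (n - i) else 0) p"
    by (rule poly_lin_lessThan[symmetric]) simp
  finally show ?thesis by simp
qed

text \<open>For \<open>k > 2 * l\<close> the lowest exponent in the polynomial is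
  \<open>2 * l + 1\<close>, beyond the coefficient taken. For \<open>k \<le> 2 * l\<close> the
  coefficient is a multiple of the binomial sum that vanishes for odd \<open>s\<close>.\<close>

lemma exp_times_bessel_nth_eq_0:
  assumes "hbar \<noteq> 0" "a < l" "l \<le> k"
  shows "(fps_of_poly (bessel_monic hbar (bessel_index l k) k) * fps_exp (2 / hbar)) $ (2 * a + 1) = 0"
proof -
  define n where "n = bessel_index l k"
  define c where "c = 2 / hbar"
  have "(fps_of_poly (bessel_monic hbar n k) * fps_exp c) $ (2 * a + 1) =
      (\<Sum>m\<le>n. bessel_coef hbar n m *
        (if k - m \<le> 2 * a + 1 then fps_exp c $ (2 * a + 1 - (k - m)) else 0))"
    by (auto simp: bessel_monic_def fps_of_poly_sum fps_of_poly_monom sum_distrib_right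
        fps_sum_nth mult.assoc fps_X_power_mult_nth not_less intro!: sum.cong)
  also have "\<dots> = 0"
  proof (cases "k \<le> 2 * l")
    case False
    then have "\<not> k - m \<le> 2 * a + 1" if "m \<le> n" for m
      using that assms(2) by (auto simp: n_def bessel_index_def)
    then show ?thesis by (intro sum.neutral) auto
  next
    case True
    \<comment> \<open>Chosen so that the index \<open>2 * a + 1 - (k - m)\<close> reads
      \<open>n + m - s\<close>; it is odd because the extracted coefficient has odd index.\<close>
    define s where "s = 2 * (l - a) - 1"
    have n: "n = 2 * l - k"
      using True by (simp add: n_def bessel_index_def)
    have "odd s"
      using assms(2) by (simp add: s_def)
    \<comment> \<open>With \<open>hbar = 2 / c\<close> the powers \<open>c ^ m\<close> cancel and
      the factorials regroup into two binomials; for \<open>s > n + m\<close> both sides are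
      zero.\<close>
    have term_eq: "bessel_coef hbar n m * (if k - m \<le> 2 * a + 1 then fps_exp c $ (2 * a + 1 - (k - m)) else 0) =
        c ^ n / c ^ s * (fact s / fact n) * (of_nat (n choose m) * (- 1 / 2) ^ m * of_nat ((n + m) choose s))"
      if "m \<le> n" for m
    proof -
      have "m \<le> k" using that n assms(3) by simp
      then have iff: "k - m \<le> 2 * a + 1 \<longleftrightarrow> s \<le> n + m" and diff: "2 * a + 1 - (k - m) = n + m - s"
        using assms(2) True by (auto simp: s_def n)
      have c: "c \<noteq> 0" "- hbar / 4 = (- 1 / 2) / c"
        using assms(1) by (auto simp: c_def)
      show ?thesis
      proof (cases "s \<le> n + m")
        case True
        then show ?thesis
          unfolding iff diff bessel_coef_def c(2) power_divide[of _ c] using that c(1)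
          by (simp add: binomial_fact power_diff power_add mult_ac)
      next
        case False
        then show ?thesis
          unfolding iff by (simp add: binomial_eq_0)
      qed
    qed
    have "(\<Sum>m\<le>n. bessel_coef hbar n m *
          (if k - m \<le> 2 * a + 1 then fps_exp c $ (2 * a + 1 - (k - m)) else 0)) =
        (\<Sum>m\<le>n. c ^ n / c ^ s * (fact s / fact n) *
          (of_nat (n choose m) * (- 1 / 2) ^ m * of_nat ((n + m) choose s)))"
      by (rule sum.cong[OF refl], rule term_eq) simp
    also have "\<dots> = 0"
      unfolding sum_distrib_left[symmetric] sum_binomial_odd_eq_0[OF \<open>odd s\<close>] by simp
    finally show ?thesis .
  qed
  finally show ?thesis by (simp add: n_def c_def)
qed

section \<open>The tau-function\<close>

lemma staircase_det_const_mult: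
  "staircase_det (fps_const c * F) l = c ^ l * staircase_det F l"
proof -
  have "staircase_det (fps_const c * F) l =
      detf l (\<lambda>a k. c * 1 * (if k \<le> 2 * a + 1 then F $ (2 * a + 1 - k) else 0))"
    unfolding staircase_det_def by (intro detf_cong) simp
  then show ?thesis
    unfolding detf_scale by (simp add: staircase_det_def)
qed

lemma fps_of_poly_prod_linear:
  fixes x :: "nat \<Rightarrow> 'a :: field"
  assumes "\<And>i. i < M \<Longrightarrow> x i \<noteq> 0"
  shows "fps_of_poly (\<Prod>i<M. [:- x i, 1:]) =
    fps_const (\<Prod>i<M. - x i) * (\<Prod>i<M. 1 - fps_const (1 / x i) * fps_X)"
  using assms
proof (induction M)
  case (Suc M)
  have "fps_of_poly [:- x M, 1:] = fps_const (- x M) * (1 - fps_const (1 / x M) * fps_X)"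
    using Suc.prems[of M] by (simp add: fps_of_poly_linear algebra_simps flip: mult.assoc)
  moreover have "fps_of_poly (\<Prod>i<M. [:- x i, 1:]) =
    fps_const (\<Prod>i<M. - x i) * (\<Prod>i<M. 1 - fps_const (1 / x i) * fps_X)"
    using Suc by simp
  ultimately show ?case
    by (simp only: prod.lessThan_Suc fps_of_poly_mult fps_const_mult[symmetric] mult_ac)
qed simp

lemma bessel_det_staircase_det:
  fixes lam :: "nat \<Rightarrow> complex"
  assumes "hbar \<noteq> 0" "\<And>i. i < M \<Longrightarrow> lam i \<noteq> 0"
  defines "E \<equiv> fps_exp (2 / hbar)"
  shows "staircase_det E l * detf M (\<lambda>i j. poly (bessel_monic hbar (bessel_index l (l + j)) (l + j)) (lam i)) =
    (\<Prod>i<M. lam i) ^ l * staircase_det (E * (\<Prod>i<M. 1 - fps_const (1 / lam i) * fps_X)) l *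
    (\<Prod>i<M. \<Prod>j\<in>{i<..<M}. (lam j - lam i))"
proof -
  \<comment> \<open>The rows of \<open>w\<close> are \<open>l\<close> functionals and \<open>M\<close> evaluations; the monic bases \<open>p\<close> and \<open>q\<close> make the
    matrix block triangular in two different ways.\<close>
  define w where "w r = (if r < l then (\<lambda>i. if i \<le> 2 * r + 1 then E $ (2 * r + 1 - i) else 0)
    else (\<lambda>i. lam (r - l) ^ i))" for r
  define P where "P = (\<Prod>i<M. [:- lam i, 1:])"
  define p where "p k = (if k < l then monom 1 k else bessel_monic hbar (bessel_index l k) k)" for k
  define q where "q k = (if k < M then monom 1 k else monom 1 (k - M) * P)" for k
  define V where "V = (\<Prod>i<M. \<Prod>j\<in>{i<..<M}. (lam j - lam i))"
  have lin_lt: "poly_lin (w r) h = (fps_of_poly h * E) $ (2 * r + 1)" if "r < l" for r h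
    using that unfolding w_def by (simp only: if_True poly_lin_fps_nth)
  have lin_ge: "poly_lin (w (l + i)) h = poly h (lam i)" for i h
    by (simp add: w_def poly_lin_powers)
  have P0: "P \<noteq> 0" and degP: "degree P = M" and monP: "coeff P M = 1"
    by (auto simp: P_def degree_prod_linear monic_prod_linear)

  \<comment> \<open>Each coefficient functional kills the Bessel polynomials \<open>p k\<close> with
    \<open>k \<ge> l\<close>, so the upper right block vanishes.\<close>
  have "detf (l + M) w = detf (l + M) (\<lambda>r k. poly_lin (w r) (p k))"
  proof (rule detf_poly_lin_monic[symmetric])
    have "bessel_index l k \<le> k" if "l \<le> k" for k
      using that by (auto simp: bessel_index_def)
    then show "degree (p k) = k" "coeff (p k) k = 1" for k
      by (auto simp: p_def degree_monom_eq degree_bessel_monic coeff_bessel_monic)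
  qed
  also have "\<dots> = detf l (\<lambda>r k. poly_lin (w r) (p k)) * detf M (\<lambda>i j. poly_lin (w (l + i)) (p (l + j)))"
  proof (rule detf_block_upper_right_zero)
    fix r k assume "r < l" "l \<le> k"
    then show "poly_lin (w r) (p k) = 0"
      using exp_times_bessel_nth_eq_0[OF assms(1), of r l k] by (simp add: lin_lt p_def E_def)
  qed
  also have "detf l (\<lambda>r k. poly_lin (w r) (p k)) = staircase_det E l"
    unfolding staircase_det_def
    by (rule detf_cong)
       (auto simp: lin_lt p_def fps_of_poly_monom fps_X_power_mult_nth)
  also have "detf M (\<lambda>i j. poly_lin (w (l + i)) (p (l + j))) =
      detf M (\<lambda>i j. poly (bessel_monic hbar (bessel_index l (l + j)) (l + j)) (lam i))"
    by (simp add: lin_ge p_def)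
  finally have 1: "detf (l + M) w = staircase_det E l * \<dots>" .

  \<comment> \<open>Multiples of \<open>P\<close> vanish at every \<open>lam i\<close>, so in this
    basis the lower right block vanishes.\<close>
  have "detf (l + M) w = detf (l + M) (\<lambda>r k. poly_lin (w r) (q k))"
  proof (rule detf_poly_lin_monic[symmetric])
    fix k
    show "degree (q k) = k"
      using P0 by (auto simp: q_def degree_monom_eq degree_mult_eq degP)
    have "coeff (monom 1 (k - M) * P) (M + (k - M)) = 1"
      by (simp add: monP coeff_monom_mult)
    then show "coeff (q k) k = 1"
      by (auto simp: q_def)
  qed
  also have "\<dots> = (- 1) ^ (l * M) * detf l (\<lambda>a b. poly_lin (w a) (q (M + b))) *
      detf M (\<lambda>i j. poly_lin (w (l + i)) (q j))"
  proof (rule detf_block_lower_right_zero)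
    fix r k assume "l \<le> r" "r < l + M" "M \<le> k"
    then obtain i where "r = l + i" "i < M"
      by (metis le_iff_add nat_add_left_cancel_less)
    then show "poly_lin (w r) (q k) = 0"
      using \<open>M \<le> k\<close> by (auto simp: lin_ge q_def P_def poly_prod)
  qed
  also have "detf M (\<lambda>i j. poly_lin (w (l + i)) (q j)) = detf M (\<lambda>i j. lam i ^ j)"
    by (rule detf_cong) (simp add: lin_ge q_def poly_monom)
  also have "\<dots> = V"
    unfolding detf_vandermonde V_def ..
  also have "detf l (\<lambda>a b. poly_lin (w a) (q (M + b))) = staircase_det (fps_of_poly P * E) l"
    unfolding staircase_det_def
  proof (rule detf_cong)
    fix a b assume "a < l" "b < l"
    have "poly_lin (w a) (q (M + b)) = (fps_X ^ b * (fps_of_poly P * E)) $ (2 * a + 1)"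
      using \<open>a < l\<close> by (simp add: lin_lt q_def fps_of_poly_mult fps_of_poly_monom mult_ac)
    then show "poly_lin (w a) (q (M + b)) =
        (if b \<le> 2 * a + 1 then (fps_of_poly P * E) $ (2 * a + 1 - b) else 0)"
      by (auto simp: fps_X_power_mult_nth)
  qed
  also have "fps_of_poly P * E = fps_const (\<Prod>i<M. - lam i) * (E * (\<Prod>i<M. 1 - fps_const (1 / lam i) * fps_X))"
    unfolding P_def using assms(2) by (subst fps_of_poly_prod_linear) (auto simp: mult_ac)
  also have "staircase_det \<dots> l = (\<Prod>i<M. - lam i) ^ l *
      staircase_det (E * (\<Prod>i<M. 1 - fps_const (1 / lam i) * fps_X)) l"
    by (rule staircase_det_const_mult)
  \<comment> \<open>This sign cancels the one from moving the columns.\<close>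
  also have "(\<Prod>i<M. - lam i) ^ l = (- 1) ^ (l * M) * (\<Prod>i<M. lam i) ^ l"
    by (simp add: prod_uminus power_mult_distrib mult.commute[of l M] flip: power_mult)
  finally show ?thesis
    unfolding 1 V_def by (simp flip: mult.assoc power_mult_distrib)
qed

text \<open>Up to sign the prefactor is the inverse of the exponential staircase determinant. Both
  become products over \<open>m < l\<close>, through \<open>m = l - k\<close>, the triangular number
  as the sum of the \<open>m + 1\<close> and \<open>l^2\<close> as the sum of the
  \<open>2 * m + 1\<close>, and are compared factor by factor.\<close>

lemma staircase_constant:
  fixes hbar :: complex
  assumes "hbar \<noteq> 0"
  shows "((- hbar) ^ (l * (l + 1) div 2) / 2 ^ (l^2) *
      (\<Prod>k=1..l. fact (2*l - 2*k + 1) / fact (l - k))) * staircase_det (fps_exp (2 / hbar)) l =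
    (\<Prod>k<l. (- 1) ^ (k + 1))"
proof -
  have "(\<Prod>k=1..l. fact (2*l - 2*k + 1) / fact (l - k)) = (\<Prod>m<l. fact (2 * m + 1) / fact m :: complex)"
    by (rule prod.reindex_bij_witness[of _ "\<lambda>m. l - m" "\<lambda>k. l - k"]) (auto simp: diff_mult_distrib2)
  moreover have "(- hbar) ^ (l * (l + 1) div 2) = (\<Prod>m<l. (- hbar) ^ (m + 1))"
  proof (induction l)
    case (Suc l)
    have "Suc l * (Suc l + 1) div 2 = l * (l + 1) div 2 + (l + 1)" by simp
    then show ?case using Suc.IH by (simp only: power_add prod.lessThan_Suc)
  qed simp
  moreover have "2 ^ (l^2) = (\<Prod>m<l. 2 ^ (2 * m + 1) :: complex)"
  proof (induction l)
    case (Suc l)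
    have "(Suc l)\<^sup>2 = l\<^sup>2 + (2 * l + 1)" by (simp add: power2_eq_square)
    then show ?case using Suc.IH by (simp only: power_add prod.lessThan_Suc)
  qed simp
  moreover have "staircase_det (fps_exp (2 / hbar)) l =
      (\<Prod>m<l. (2 / hbar) ^ (m + 1) * 2 ^ m * fact m / fact (2 * m + 1))"
    using assms by (intro staircase_det_exp) simp
  moreover have "(- hbar) ^ (m + 1) / 2 ^ (2 * m + 1) * (fact (2 * m + 1) / fact m) *
      ((2 / hbar) ^ (m + 1) * 2 ^ m * fact m / fact (2 * m + 1)) = (- 1) ^ (m + 1)" for m
  proof -
    have "(- hbar) ^ (m + 1) * (2 / hbar) ^ (m + 1) = (- 1) ^ (m + 1) * 2 ^ (m + 1)"
      using assms by (simp flip: power_mult_distrib del: power_Suc)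
    moreover have "2 ^ (2 * m + 1) = (2 ^ (m + 1) * 2 ^ m :: complex)"
    proof -
      have "2 * m + 1 = (m + 1) + m" by simp
      then show ?thesis by (simp only: power_add)
    qed
    moreover have "x / (t * u) * (F / G) * (y * u * G / F) = s"
      if "x * y = s * t" "t \<noteq> 0" "u \<noteq> 0" "F \<noteq> 0" "G \<noteq> 0" for x y s t u F G :: complex
    proof -
      have "x / (t * u) * (F / G) * (y * u * G / F) = x * y / t"
        using that(2-) by simp
      then show ?thesis using that(1,2) by simp
    qed
    ultimately show ?thesis
      by (simp del: power_Suc fact_Suc)
  qed
  ultimately show ?thesis
    by (simp only: flip: prod.distrib prod_dividef)
qed

theorem mainTheorem7:
  fixes l :: nat and hbar :: complex
  assumes "hbar \<noteq> 0"
  shows "is_BGW_tau (of_nat l + 1/2) hbar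
           (\<lambda>t. ((- hbar) ^ (l * (l + 1) div 2) / 2 ^ (l^2)
                   * (\<Prod>k=1..l. fact (2*l - 2*k + 1) / fact (l - k)))
                 * schur (staircase l) (dilaton hbar t))"
  unfolding is_BGW_tau_def
proof (intro allI impI)
  fix M :: nat and lam :: "nat \<Rightarrow> complex"
  assume "1 \<le> M" and lam: "inj_on lam {..<M} \<and> (\<forall>i<M. lam i \<noteq> 0)"
  define C where "C = (- hbar) ^ (l * (l + 1) div 2) / 2 ^ (l^2) *
    (\<Prod>k=1..l. fact (2*l - 2*k + 1) / fact (l - k) :: complex)"
  define sgn where "sgn = (\<Prod>k<l. (- 1) ^ (k + 1) :: complex)"
  define E where "E = fps_exp (2 / hbar)"
  define Q where "Q = E * (\<Prod>i<M. 1 - fps_const (1 / lam i) * fps_X)"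
  define H where "H = fps_exp 1 oo Abs_fps (\<lambda>n. if n = 0 then 0 else dilaton hbar (miwa M lam) n)"
  define V where "V = (\<Prod>i<M. \<Prod>j\<in>{i<..<M}. (lam j - lam i))"
  define D where "D = detf M (\<lambda>i j. poly (bessel_monic hbar (bessel_index l (l + j)) (l + j)) (lam i))"
  have "V \<noteq> 0"
  proof -
    have "lam j \<noteq> lam i" if "i < j" "j < M" for i j
      using lam that by (metis inj_on_def lessThan_iff less_trans less_irrefl)
    then show ?thesis by (auto simp: V_def)
  qed
  have prod0: "(\<Prod>i<M. lam i) ^ l \<noteq> 0"
    using lam by auto
  have "Q $ 0 = 1"
    unfolding Q_def E_def by (induction M) simp_all
  moreover have "H * Q = 1"
    unfolding H_def Q_def E_def using lam assms by (intro exp_miwa_times) auto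
  ultimately have Q: "staircase_det Q l = sgn * staircase_det H l"
    unfolding sgn_def by (intro staircase_det_inverse)
  have sgn: "sgn * sgn = 1"
    by (simp add: sgn_def flip: prod.distrib power_mult_distrib)
  have C: "C * staircase_det E l = sgn"
    unfolding C_def E_def sgn_def by (rule staircase_constant[OF assms])
  have D: "staircase_det E l * D = (\<Prod>i<M. lam i) ^ l * staircase_det Q l * V"
    unfolding D_def E_def Q_def V_def using lam assms by (intro bessel_det_staircase_det) auto
  have "detf M (\<lambda>i j. Phi (of_nat l + 1/2) hbar (int j + 1) (lam i)) =
      detf M (\<lambda>i j. (1 / lam i ^ l) * 1 * poly (bessel_monic hbar (bessel_index l (l + j)) (l + j)) (lam i))"
    using lam by (intro detf_cong) (simp add: Phi_half_integer)
  also have "\<dots> = D / (\<Prod>i<M. lam i) ^ l"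
    unfolding detf_scale D_def by (simp add: prod_dividef prod_power_distrib)
  finally have "BGW_det_ratio (of_nat l + 1/2) hbar M lam = D / (\<Prod>i<M. lam i) ^ l / V"
    by (simp add: BGW_det_ratio_def V_def)
  also have "\<dots> = C * staircase_det H l"
  proof -
    \<comment> \<open>One \<open>sgn\<close> is traded for \<open>C * staircase_det E l\<close>, so
      that the determinant identity applies without a division; the other cancels the sign from
      inverting \<open>Q\<close>.\<close>
    have "D = sgn * sgn * D" using sgn by simp
    also have "\<dots> = sgn * C * (staircase_det E l * D)" by (simp only: C[symmetric] mult_ac)
    also have "\<dots> = (sgn * sgn) * C * staircase_det H l * (\<Prod>i<M. lam i) ^ l * V"
      unfolding D Q by (simp add: mult_ac)
    finally have "D = C * staircase_det H l * (\<Prod>i<M. lam i) ^ l * V"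
      using sgn by simp
    moreover have "d / a / v = x" if "d = x * a * v" "a \<noteq> 0" "v \<noteq> 0" for a d v x :: complex
      using that by simp
    ultimately show ?thesis
      using \<open>V \<noteq> 0\<close> prod0 by blast
  qed
  also have "\<dots> = C * schur (staircase l) (dilaton hbar (miwa M lam))"
    by (simp add: schur_staircase H_def)
  finally show "(- hbar) ^ (l * (l + 1) div 2) / 2 ^ (l^2) *
      (\<Prod>k=1..l. fact (2*l - 2*k + 1) / fact (l - k)) *
      schur (staircase l) (dilaton hbar (miwa M lam)) = BGW_det_ratio (of_nat l + 1/2) hbar M lam"
    unfolding C_def by simp
qed

end
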